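(* Let $\lambda$ be an uncountable cardinal and let $X\subseteq 2^\lambda$ be an $\mathrm{HFC}$ space (with the subspace topology inherited from the Tychonoff product $2^\lambda$). Then $X$ is dually discrete.
   Context: For a finite partial function $s$ from $\lambda$ to $2$, $[s]=\{x\in 2^\lambda: x\supset s\}$ is the corresponding basic open subset of the Tychonoff product $2^\lambda$ ($2=\{0,1\}$ discrete). For $n<\omega$, $F\in[\lambda]^n$ (an $n$-element subset of $\lambda$) and $b\in 2^n$, $F*b$ denotes the function from $F$ to $2$ taking value $b(i)$ on the $i$-th element of $F$ (in increasing order). A subspace $X\subseteq 2^\lambda$ is called $\mathrm{HFC}$ if for every $n\in\omega$, every $b\in 2^n$ and every infinite family $\mathcal F\subseteq[\lambda]^n$ of pairwise disjoint sets, the set $X\setminus\bigcup\{[F*b]:F\in\mathcal F\}$ is countable. A neighbourhood assignment on a topological space $X$ is a family $\{U_x:x\in X\}$ of open subsets of $X$ with $x\in U_x$ for every $x\in X$. A space $X$ is dually discrete if for every neighbourhood assignment $\{U_x:x\in X\}$ there is a $D\subseteq X$ which is discrete (in its subspace topology) such that $\{U_x:x\in D\}$ covers $X$. *)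

theory Defs
  imports "HOL-Analysis.Analysis" "HOL-Library.Ramsey" "HOL-Library.Disjoint_Sets"
begin

(* A cardinal is a cardinal order r in the sense of Card_order; the ordinals below it are the
   elements of Field r, increasingly ordered by r.  The two-point space 2 is bool. *)

definition cantor_cube :: "'a rel \<Rightarrow> ('a \<Rightarrow> bool) topology" where
  "cantor_cube r = product_topology (\<lambda>_. discrete_topology (UNIV :: bool set)) (Field r)"

(* [s] for a partial function s; points of the cube are functions extensional on Field r. *)
definition basic_open :: "'a rel \<Rightarrow> ('a \<rightharpoonup> bool) \<Rightarrow> ('a \<Rightarrow> bool) set" where
  "basic_open r s = {x \<in> topspace (cantor_cube r). \<forall>a\<in>dom s. s a = Some (x a)}"

(* F * b: an element a of F is the i-th element of F (counting from 0), where i is the number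
   of elements of F strictly below a. *)
definition star :: "'a rel \<Rightarrow> 'a set \<Rightarrow> (nat \<Rightarrow> bool) \<Rightarrow> ('a \<rightharpoonup> bool)" where
  "star r F b = (\<lambda>a. if a \<in> F then Some (b (card (F \<inter> underS r a))) else None)"

definition HFC :: "'a rel \<Rightarrow> ('a \<Rightarrow> bool) set \<Rightarrow> bool" where
  "HFC r X \<longleftrightarrow>
     X \<subseteq> topspace (cantor_cube r) \<and>
     (\<forall>n::nat. \<forall>b \<in> {..<n} \<rightarrow>\<^sub>E (UNIV :: bool set). \<forall>\<F> \<subseteq> nsets (Field r) n.
        infinite \<F> \<longrightarrow> disjoint \<F> \<longrightarrow>
        countable (X - (\<Union>F\<in>\<F>. basic_open r (star r F b))))"

definition neighbourhood_assignment :: "'b topology \<Rightarrow> ('b \<Rightarrow> 'b set) \<Rightarrow> bool" where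
  "neighbourhood_assignment T U \<longleftrightarrow> (\<forall>x\<in>topspace T. openin T (U x) \<and> x \<in> U x)"

definition dually_discrete :: "'b topology \<Rightarrow> bool" where
  "dually_discrete T \<longleftrightarrow>
     (\<forall>U. neighbourhood_assignment T U \<longrightarrow>
        (\<exists>D \<subseteq> topspace T. subtopology T D = discrete_topology D \<and>
           (\<Union>x\<in>D. U x) = topspace T))"

end

theory Submission
  imports Defs
begin

text \<open>The set \<open>D\<close> can even be taken closed and discrete in \<open>X\<close>. Shrink the assignment to cylinders
  \<open>U x = [s x]\<close> and treat the points with \<open>|s x| = n\<close> one \<open>n\<close> after the other, so fix \<open>n\<close>.
  Two consequences of HFC drive the argument. For an infinite set \<open>N\<close> of coordinates the fibres of
  the restriction \<open>X \<rightarrow> 2\<^sup>N\<close> are countable. And if infinitely many distinct cylinders of bounded size are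
  given, then some cylinder \<open>[c]\<close>, with \<open>c\<close> strictly smaller than the maximal size, is covered by
  them up to a countable set.

  Suppose the points of a closed \<open>E\<close> cannot be covered. Fix a countable \<open>N\<close>; by compactness some
  \<open>q \<in> 2\<^sup>N\<close> has no basic neighbourhood over which they can be covered. Cover the countable
  fibre over \<open>q\<close> by a closed discrete set, and, outside what has been covered so far and ever closer to
  \<open>q\<close>, choose closed discrete sets \<open>A 0, A 1, \<dots>\<close> such that \<open>A k\<close> covers a cylinder \<open>[c k]\<close> up to
  countably many points, with the \<open>c k\<close> distinct. Their union can only accumulate at the fibre over
  \<open>q\<close>, which it avoids, so it is closed discrete, and it covers up to countably many points a
  cylinder \<open>[d]\<close> with \<open>d\<close> smaller than the \<open>c k\<close>. Starting from the cylinders \<open>[s x]\<close> one descends to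
  \<open>d = {}\<close>: all of \<open>X\<close> up to a countable set is covered, and that set is dealt with greedily.\<close>

section \<open>Closed discrete sets\<close>

text \<open>Having no accumulation point anywhere in the space expresses closedness and relative
  discreteness in one equation, which passes to finite unions at once.\<close>

definition closed_discrete :: "'b topology \<Rightarrow> 'b set \<Rightarrow> bool" where
  "closed_discrete T D \<longleftrightarrow> D \<subseteq> topspace T \<and> T derived_set_of D = {}"

lemma closed_discrete_empty: "closed_discrete T {}"
  by (simp add: closed_discrete_def)

lemma closed_discrete_Un:
  "closed_discrete T A \<Longrightarrow> closed_discrete T B \<Longrightarrow> closed_discrete T (A \<union> B)"
  by (auto simp: closed_discrete_def derived_set_of_Un)

lemma closed_discrete_UN:
  "finite I \<Longrightarrow> (\<And>i. i \<in> I \<Longrightarrow> closed_discrete T (A i)) \<Longrightarrow> closed_discrete T (\<Union>i\<in>I. A i)"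
  by (induction I rule: finite_induct) (auto simp: closed_discrete_empty closed_discrete_Un)

lemma closed_discrete_singleton:
  "t1_space T \<Longrightarrow> x \<in> topspace T \<Longrightarrow> closed_discrete T {x}"
  by (simp add: closed_discrete_def t1_space_derived_set_of_singleton)

text \<open>Accumulation is local: an accumulation point of \<open>D\<close> lying in an open
  \<open>V\<close> is one of \<open>V \<inter> D\<close>, hence of \<open>A\<close>. The set
  \<open>A\<close> may vary with the point.\<close>

lemma closed_discreteI:
  assumes "D \<subseteq> topspace T"
    and "\<And>x. x \<in> topspace T \<Longrightarrow> \<exists>V A. openin T V \<and> x \<in> V \<and> closed_discrete T A \<and> V \<inter> D \<subseteq> A"
  shows "closed_discrete T D"
proof -
  have False if "x \<in> T derived_set_of D" for x
  proof -
    have x: "x \<in> topspace T"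
      using that by (simp add: in_derived_set_of)
    then obtain V A where V: "openin T V" "x \<in> V" "closed_discrete T A" "V \<inter> D \<subseteq> A"
      using assms(2) by blast
    have "x \<in> T derived_set_of (V \<inter> D)"
      using openin_Int_derived_set_of_subset[OF V(1), of D] V(2) that by blast
    then have "x \<in> T derived_set_of A"
      using derived_set_of_mono[OF V(4)] by blast
    then show False
      using V(3) by (simp add: closed_discrete_def)
  qed
  then show ?thesis
    using assms(1) by (auto simp: closed_discrete_def)
qed

lemma subtopology_closed_discrete:
  "closed_discrete T D \<Longrightarrow> subtopology T D = discrete_topology D"
  by (simp add: closed_discrete_def subtopology_eq_discrete_topology_eq)

text \<open>The usual greedy argument: each block avoids the open set covered by the earlier ones, so
  every covered point has a neighbourhood meeting only finitely many blocks.\<close>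

lemma closed_discrete_cover_stack:
  fixes S :: "nat \<Rightarrow> 'b set"
  assumes U: "neighbourhood_assignment T U"
    and P: "closedin T P"
    and cover: "P \<subseteq> (\<Union>n. S n)"
    and step: "\<And>n E. closedin T E \<Longrightarrow> E \<subseteq> P \<Longrightarrow>
      \<exists>D\<subseteq>E. closed_discrete T D \<and> S n \<inter> E \<subseteq> (\<Union>x\<in>D. U x)"
  shows "\<exists>D\<subseteq>P. closed_discrete T D \<and> P \<subseteq> (\<Union>x\<in>D. U x)"
proof -
  let ?U = "\<lambda>D. \<Union>x\<in>D. U x"
  have opU: "openin T (?U D)" if "D \<subseteq> topspace T" for D
    using U that unfolding neighbourhood_assignment_def by blast
  have PT: "P \<subseteq> topspace T"
    using P closedin_subset by blast
  \<comment> \<open>\<open>G n\<close> unites the blocks chosen so far. The clause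
    \<open>?U (G n) \<inter> G (Suc n) \<subseteq> G n\<close> keeps the new block off the open set
    already covered.\<close>
  have "\<exists>G. \<forall>n. (closed_discrete T (G n) \<and> G n \<subseteq> P) \<and>
      (G n \<subseteq> G (Suc n) \<and> ?U (G n) \<inter> G (Suc n) \<subseteq> G n \<and> S n \<inter> P \<subseteq> ?U (G (Suc n)))"
    (is "\<exists>G. ?Q G")
  proof (rule dependent_nat_choice)
    show "\<exists>G. closed_discrete T G \<and> G \<subseteq> P"
      using closed_discrete_empty by blast
  next
    fix G and n :: nat
    assume G: "closed_discrete T G \<and> G \<subseteq> P"
    have "closedin T (P - ?U G)"
      using P opU[of G] G PT by (intro closedin_diff) auto
    then obtain D where D: "D \<subseteq> P - ?U G" "closed_discrete T D" "S n \<inter> (P - ?U G) \<subseteq> ?U D"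
      using step[of "P - ?U G" n] by blast
    show "\<exists>H. (closed_discrete T H \<and> H \<subseteq> P) \<and>
      (G \<subseteq> H \<and> ?U G \<inter> H \<subseteq> G \<and> S n \<inter> P \<subseteq> ?U H)"
    proof (intro exI[of _ "G \<union> D"] conjI)
      show "closed_discrete T (G \<union> D)"
        using G D(2) by (simp add: closed_discrete_Un)
      show "?U G \<inter> (G \<union> D) \<subseteq> G" "G \<union> D \<subseteq> P"
        using G D(1) by auto
      show "S n \<inter> P \<subseteq> ?U (G \<union> D)"
        using D(3) by auto
    qed simp
  qed
  then obtain G where "?Q G" ..
  then have G: "\<And>n. closed_discrete T (G n)" "\<And>n. G n \<subseteq> P" "\<And>n. G n \<subseteq> G (Suc n)"
      "\<And>n. ?U (G n) \<inter> G (Suc n) \<subseteq> G n" "\<And>n. S n \<inter> P \<subseteq> ?U (G (Suc n))"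
    by metis+
  have mono: "G m \<subseteq> G n" if "m \<le> n" for m n
    using that by (rule lift_Suc_mono_le[of G, OF G(3)])
  \<comment> \<open>Iterated over \<open>n\<close>, the clause makes \<open>?U (G m)\<close> an open
    set that meets the final union only in \<open>G m\<close>.\<close>
  have stable: "?U (G m) \<inter> G n \<subseteq> G m" for m n
  proof (cases "m \<le> n")
    case True
    then show ?thesis
    proof (induction n rule: dec_induct)
      case (step n)
      then have "?U (G m) \<subseteq> ?U (G n)"
        using mono by blast
      then show ?case
        using G(4)[of n] step.IH by blast
    qed simp
  next
    case False
    then show ?thesis
      using mono[of n m] by auto
  qed
  let ?D = "\<Union>n. G n"
  have "closed_discrete T ?D"
  proof (rule closed_discreteI)
    show "?D \<subseteq> topspace T"
      using G(2) PT by blast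
    fix x assume x: "x \<in> topspace T"
    show "\<exists>V A. openin T V \<and> x \<in> V \<and> closed_discrete T A \<and> V \<inter> ?D \<subseteq> A"
    proof (cases "x \<in> P")
      case True
      then obtain n where "x \<in> ?U (G (Suc n))"
        using cover G(5) by blast
      moreover have "openin T (?U (G (Suc n)))"
        using G(2) PT by (intro opU) (rule order_trans)
      moreover have "?U (G (Suc n)) \<inter> ?D \<subseteq> G (Suc n)"
        using stable[of "Suc n"] by (simp only: Int_UN_distrib UN_least)
      ultimately show ?thesis
        using G(1) by metis
    next
      case False
      then show ?thesis
        using P x G(2) closed_discrete_empty
        by (intro exI[of _ "topspace T - P"] exI[of _ "{}"]) (auto simp: closedin_def)
    qed
  qed
  moreover have "P \<subseteq> ?U ?D"
  proof
    fix x assume "x \<in> P"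
    then obtain n where "x \<in> S n \<inter> P"
      using cover by auto
    then have "x \<in> ?U (G (Suc n))"
      by (rule subsetD[OF G(5)])
    then show "x \<in> ?U ?D"
      by auto
  qed
  moreover have "?D \<subseteq> P"
    using G(2) by (rule UN_least)
  ultimately show ?thesis
    by metis
qed

lemma closed_discrete_cover_countable:
  assumes U: "neighbourhood_assignment T U" and "t1_space T"
    and P: "closedin T P" and "countable P"
  shows "\<exists>D\<subseteq>P. closed_discrete T D \<and> P \<subseteq> (\<Union>x\<in>D. U x)"
proof (rule closed_discrete_cover_stack[OF U P])
  show "P \<subseteq> (\<Union>n. {from_nat_into P n})"
    using from_nat_into_surj[OF \<open>countable P\<close>] by blast
  fix n E
  assume E: "closedin T E" "E \<subseteq> P"
  let ?y = "from_nat_into P n"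
  show "\<exists>D\<subseteq>E. closed_discrete T D \<and> {?y} \<inter> E \<subseteq> (\<Union>x\<in>D. U x)"
  proof (cases "?y \<in> E")
    case True
    then have "?y \<in> topspace T"
      using E closedin_subset by blast
    then show ?thesis
      using True U closed_discrete_singleton[OF \<open>t1_space T\<close>]
      by (intro exI[of _ "{?y}"]) (auto simp: neighbourhood_assignment_def)
  next
    \<comment> \<open>In the stacking, \<open>?y\<close> may have been covered earlier, and it is an
      arbitrary value if \<open>P\<close> is empty; nothing is added.\<close>
    case False
    then show ?thesis
      using closed_discrete_empty by blast
  qed
qed

section \<open>Cylinders in an HFC space\<close>

text \<open>Partial functions are encoded by their graphs, so that size, extension and root become
  cardinality and inclusion. If \<open>c\<close> is not single-valued, the cylinder is
  empty.\<close>

definition cylinder :: "('a \<Rightarrow> bool) set \<Rightarrow> ('a \<times> bool) set \<Rightarrow> ('a \<Rightarrow> bool) set" where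
  "cylinder X c = {x \<in> X. \<forall>(a, i)\<in>c. x a = i}"

text \<open>The rank inside \<open>F\<close> grows strictly along \<open>r\<close>, so the index
  used by \<open>star\<close> enumerates \<open>F\<close> without repetition.\<close>

lemma inj_on_card_underS:
  assumes "Well_order r" and "finite F" and "F \<subseteq> Field r"
  shows "inj_on (\<lambda>a. card (F \<inter> underS r a)) F"
proof (rule inj_onI)
  have less: "card (F \<inter> underS r a) < card (F \<inter> underS r b)"
    if "a \<in> F" "b \<in> F" "a \<noteq> b" "(a, b) \<in> r" for a b
  proof (rule psubset_card_mono)
    have "trans r" "antisym r"
      using assms(1) by (auto simp: order_on_defs)
    then have "underS r a \<subseteq> underS r b"
      using that by (auto simp: underS_def dest: transD antisymD)
    moreover have "a \<in> underS r b" "a \<notin> underS r a"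
      using that by (auto simp: underS_def)
    ultimately show "F \<inter> underS r a \<subset> F \<inter> underS r b"
      using that by blast
  qed (use assms in auto)
  fix a b assume ab: "a \<in> F" "b \<in> F" "card (F \<inter> underS r a) = card (F \<inter> underS r b)"
  show "a = b"
  proof (rule ccontr)
    assume "a \<noteq> b"
    then have "(a, b) \<in> r \<or> (b, a) \<in> r"
      using assms ab by (auto simp: order_on_defs total_on_def)
    then show False
      using less[of a b] less[of b a] ab \<open>a \<noteq> b\<close> by auto
  qed
qed

lemma card_underS_less:
  assumes "finite F" and "a \<in> F"
  shows "card (F \<inter> underS r a) < card F"
  by (rule psubset_card_mono) (use assms in \<open>auto simp: underS_def\<close>)

text \<open>Inverting the rank turns an arbitrary \<open>g\<close> on \<open>F\<close> into a
  pattern \<open>b\<close>.\<close>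

lemma star_pattern:
  assumes "Well_order r" and "finite F" and "F \<subseteq> Field r"
  obtains b where "b \<in> {..<card F} \<rightarrow>\<^sub>E (UNIV :: bool set)"
    and "\<And>a. a \<in> F \<Longrightarrow> star r F b a = Some (g a)"
proof (rule that)
  define idx where "idx a = card (F \<inter> underS r a)" for a
  define b where "b = restrict (\<lambda>i. g (inv_into F idx i)) {..<card F}"
  show "b \<in> {..<card F} \<rightarrow>\<^sub>E (UNIV :: bool set)"
    by (simp add: b_def)
  fix a assume a: "a \<in> F"
  have "inj_on idx F"
    using inj_on_card_underS[OF assms] by (simp add: idx_def[abs_def])
  then have "inv_into F idx (idx a) = a"
    using a by (rule inv_into_f_f)
  moreover have "idx a < card F"
    using card_underS_less[OF assms(2) a] by (simp add: idx_def)
  ultimately show "star r F b a = Some (g a)"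
    using a by (simp add: star_def b_def flip: idx_def)
qed

text \<open>Every cylinder of a well-ordered cube is some \<open>F * b\<close>; by the pigeonhole principle
  infinitely many of the given cylinders share one \<open>b\<close>.\<close>

lemma HFC_disjoint_cylinders:
  fixes C :: "('a \<times> bool) set set"
  assumes wo: "Well_order r" and X: "HFC r X" and inf: "infinite C"
    and C: "\<And>c. c \<in> C \<Longrightarrow> finite c \<and> card c \<le> m \<and> c \<subseteq> Field r \<times> UNIV \<and> single_valued c"
    and disj: "\<And>c d. c \<in> C \<Longrightarrow> d \<in> C \<Longrightarrow> c \<noteq> d \<Longrightarrow> fst ` c \<inter> fst ` d = {}"
  shows "countable (X - (\<Union>c\<in>C. cylinder X c))"
proof -
  \<comment> \<open>\<open>?Q c n b\<close> says that \<open>b\<close> codes \<open>c\<close> on its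
    domain of size \<open>n\<close>; the set \<open>?I\<close> of possible codes is finite because
    of the bound \<open>m\<close>.\<close>
  let ?Q = "\<lambda>c n b. card (fst ` c) = n \<and> X \<inter> basic_open r (star r (fst ` c) b) \<subseteq> cylinder X c"
  let ?I = "SIGMA n:{..m}. {..<n} \<rightarrow>\<^sub>E (UNIV :: bool set)"
  have ex: "\<exists>p\<in>?I. ?Q c (fst p) (snd p)" if cC: "c \<in> C" for c
  proof -
    define g where "g a = (SOME i. (a, i) \<in> c)" for a
    have g: "g a = i" if "(a, i) \<in> c" for a i
    proof -
      have "(a, g a) \<in> c"
        unfolding g_def using that by (rule someI)
      then show ?thesis
        using C[OF cC] that by (blast dest: single_valuedD)
    qed
    have fin: "finite (fst ` c)" and sub: "fst ` c \<subseteq> Field r"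
      using C[OF cC] by auto
    obtain b where b: "b \<in> {..<card (fst ` c)} \<rightarrow>\<^sub>E (UNIV :: bool set)"
        and bg: "\<And>a. a \<in> fst ` c \<Longrightarrow> star r (fst ` c) b a = Some (g a)"
      using star_pattern[OF wo fin sub, of g] by metis
    have "card (fst ` c) \<le> m"
      using C[OF cC] card_image_le[of c fst] by auto
    moreover have "X \<inter> basic_open r (star r (fst ` c) b) \<subseteq> cylinder X c"
    proof
      fix y assume y: "y \<in> X \<inter> basic_open r (star r (fst ` c) b)"
      have "y a = i" if ai: "(a, i) \<in> c" for a i
      proof -
        have a: "a \<in> fst ` c"
          using ai by force
        then have "a \<in> dom (star r (fst ` c) b)"
          using bg by auto
        then have "Some (y a) = star r (fst ` c) b a"
          using y by (simp add: basic_open_def)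
        then show ?thesis
          using bg[OF a] g[OF ai] by auto
      qed
      then show "y \<in> cylinder X c"
        using y by (auto simp: cylinder_def)
    qed
    ultimately show ?thesis
      using b by (intro bexI[of _ "(card (fst ` c), b)"]) auto
  qed
  have fin: "finite ?I"
    by (intro finite_SigmaI finite_PiE) auto
  have "\<exists>p\<in>?I. infinite {c \<in> C. ?Q c (fst p) (snd p)}"
    by (rule pigeonhole_infinite_rel[OF inf fin]) (rule ballI[OF ex])
  then obtain p where p: "p \<in> ?I" and infn: "infinite {c \<in> C. ?Q c (fst p) (snd p)}" ..
  obtain n b where pnb: "p = (n, b)"
    by fastforce
  define C' where "C' = {c \<in> C. ?Q c n b}"
  have C'C: "C' \<subseteq> C" and Q: "\<And>c. c \<in> C' \<Longrightarrow> ?Q c n b"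
    by (auto simp: C'_def)
  have b: "b \<in> {..<n} \<rightarrow>\<^sub>E (UNIV :: bool set)"
    using p pnb by auto
  let ?F = "image fst ` C'"
  \<comment> \<open>HFC asks for infinitely many domains. Distinct members have disjoint domains, so
    nonempty ones cannot share a domain.\<close>
  have inj: "inj_on (image fst) (C' - {{}})"
  proof (rule inj_onI, rule ccontr)
    fix c d assume cd: "c \<in> C' - {{}}" "d \<in> C' - {{}}" "fst ` c = fst ` d" "c \<noteq> d"
    then have "fst ` c \<inter> fst ` d = {}"
      using disj C'C by blast
    then show False
      using cd by auto
  qed
  have "infinite C'"
    using infn by (simp add: C'_def pnb)
  then have "infinite (image fst ` (C' - {{}}))"
    using inj by (simp add: finite_image_iff)
  then have "infinite ?F"
    by (meson Diff_subset finite_subset image_mono)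
  moreover have "?F \<subseteq> nsets (Field r) n"
  proof
    fix F assume "F \<in> ?F"
    then obtain c where c: "c \<in> C'" "F = fst ` c"
      by blast
    then have "finite c" "c \<subseteq> Field r \<times> UNIV" "card F = n"
      using C[of c] Q[of c] C'C by auto
    then show "F \<in> nsets (Field r) n"
      using c(2) by (auto simp: nsets_def)
  qed
  moreover have "disjoint ?F"
    unfolding disjoint_def using disj C'C by blast
  ultimately have "countable (X - (\<Union>F\<in>?F. basic_open r (star r F b)))"
    using X b unfolding HFC_def by meson
  moreover have "X - (\<Union>c\<in>C. cylinder X c) \<subseteq> X - (\<Union>F\<in>?F. basic_open r (star r F b))"
    using Q C'C by blast
  ultimately show ?thesis
    by (rule countable_subset[rotated])
qed

text \<open>Ramsey's theorem, with pairs coloured by whether they meet. In a homogeneous set of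
  meeting pairs, infinitely many members would meet one finite \<open>f c\<close>, although each of
  its points lies in only finitely many.\<close>

lemma infinite_disjoint_subfamily:
  assumes "infinite C" and fin: "\<And>c. c \<in> C \<Longrightarrow> finite (f c)"
    and pt: "\<And>a. finite {c \<in> C. a \<in> f c}"
  obtains D where "D \<subseteq> C" "infinite D"
    and "\<And>c d. c \<in> D \<Longrightarrow> d \<in> D \<Longrightarrow> c \<noteq> d \<Longrightarrow> f c \<inter> f d = {}"
proof -
  define g where "g p = (if \<exists>c d. p = {c, d} \<and> c \<noteq> d \<and> f c \<inter> f d \<noteq> {} then 1 else 0 :: nat)" for p
  have g2: "\<forall>c\<in>C. \<forall>d\<in>C. c \<noteq> d \<longrightarrow> g {c, d} < 2"
    by (simp add: g_def)
  obtain D t where D: "D \<subseteq> C" "infinite D" and t: "\<forall>c\<in>D. \<forall>d\<in>D. c \<noteq> d \<longrightarrow> g {c, d} = t"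
    using Ramsey2[OF \<open>infinite C\<close> g2] by blast
  have g: "g {c, d} = (if f c \<inter> f d \<noteq> {} then 1 else 0)" if "c \<noteq> d" for c d
    unfolding g_def by (rule if_cong) (use that in \<open>auto simp: doubleton_eq_iff\<close>)
  have "t = 0"
  proof (rule ccontr)
    assume "t \<noteq> 0"
    obtain c where c: "c \<in> D"
      using D(2) by fastforce
    have "D - {c} \<subseteq> (\<Union>a\<in>f c. {d \<in> C. a \<in> f d})"
    proof
      fix d assume d: "d \<in> D - {c}"
      then have "g {c, d} \<noteq> 0"
        using t c \<open>t \<noteq> 0\<close> by auto
      then have "f c \<inter> f d \<noteq> {}"
        using d g[of c d] by (auto split: if_splits)
      then show "d \<in> (\<Union>a\<in>f c. {d \<in> C. a \<in> f d})"
        using d D(1) by blast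
    qed
    moreover have "finite (\<Union>a\<in>f c. {d \<in> C. a \<in> f d})"
      using fin[of c] c D(1) pt by auto
    ultimately have "finite (D - {c})"
      by (rule finite_subset)
    then show False
      using D(2) by simp
  qed
  have "f c \<inter> f d = {}" if "c \<in> D" "d \<in> D" "c \<noteq> d" for c d
  proof (rule ccontr)
    assume "f c \<inter> f d \<noteq> {}"
    then have "g {c, d} = 1"
      using g[OF that(3)] by simp
    then show False
      using t that \<open>t = 0\<close> by simp
  qed
  then show ?thesis
    using that D by blast
qed

text \<open>The set \<open>c\<close> is the root of an infinite \<open>\<Delta>\<close>-system contained in \<open>C\<close>.\<close>

lemma HFC_cylinders_root:
  fixes C :: "('a \<times> bool) set set"
  assumes wo: "Well_order r" and X: "HFC r X" and "infinite C"
    and "\<And>c. c \<in> C \<Longrightarrow> finite c \<and> card c \<le> Suc m \<and> c \<subseteq> Field r \<times> UNIV \<and> single_valued c"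
  shows "\<exists>c. card c \<le> m \<and> (\<exists>d\<in>C. c \<subseteq> d) \<and> countable (cylinder X c - (\<Union>d\<in>C. cylinder X d))"
  using assms(3,4)
proof (induction m arbitrary: C rule: nat_less_induct)
  case (1 m C)
  have inf: "infinite C"
    and C: "\<And>c. c \<in> C \<Longrightarrow> finite c \<and> card c \<le> Suc m \<and> c \<subseteq> Field r \<times> UNIV \<and> single_valued c"
    using 1 by blast+
  show ?case
  proof (cases "\<exists>p. infinite {c \<in> C. p \<in> c}")
    \<comment> \<open>A pair \<open>p\<close> common to infinitely many members is removed, which
      lowers the size bound by one, and is put back into the root found afterwards.\<close>
    case True
    then obtain p where p: "infinite {c \<in> C. p \<in> c}"
      by blast
    define C' where "C' = (\<lambda>c. c - {p}) ` {c \<in> C. p \<in> c}"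
    have "inj_on (\<lambda>c. c - {p}) {c \<in> C. p \<in> c}"
      by (intro inj_onI) blast
    then have inf': "infinite C'"
      using p by (simp add: C'_def finite_image_iff)
    have C': "finite c \<and> card c \<le> m \<and> c \<subseteq> Field r \<times> UNIV \<and> single_valued c" if c: "c \<in> C'" for c
    proof -
      obtain d where d: "d \<in> C" "p \<in> d" "c = d - {p}"
        using c by (auto simp: C'_def)
      then have "Suc (card c) = card d"
        using C[of d] card_Suc_Diff1[of d p] by blast
      then show ?thesis
        using C[of d] d single_valued_subset[of c d] by auto
    qed
    \<comment> \<open>For \<open>m = 0\<close> every member of \<open>C'\<close> would be empty; so
      the induction hypothesis is available at \<open>m - 1\<close>.\<close>
    have "m \<noteq> 0"
    proof
      assume "m = 0"
      have "c = {}" if "c \<in> C'" for c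
        using C'[OF that] \<open>m = 0\<close> by (metis card_0_eq le_zero_eq)
      then have "C' \<subseteq> {{}}"
        by blast
      then show False
        using inf' finite_subset by blast
    qed
    then obtain k where k: "m = Suc k"
      using not0_implies_Suc by blast
    obtain c d where c: "card c \<le> k" "d \<in> C'" "c \<subseteq> d"
        and cnt: "countable (cylinder X c - (\<Union>d\<in>C'. cylinder X d))"
      using 1(1)[rule_format, of k C'] inf' C' k by auto
    have "card (insert p c) \<le> m"
      using card_insert_le_m1[of m c p] c(1) k by simp
    moreover have "\<exists>d\<in>C. insert p c \<subseteq> d"
      using c(2,3) by (auto simp: C'_def)
    \<comment> \<open>On points that satisfy \<open>p\<close>, the cylinders of \<open>d\<close> and
      of \<open>d - {p}\<close> agree.\<close>
    moreover have "cylinder X (insert p c) - (\<Union>d\<in>C. cylinder X d)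
        \<subseteq> cylinder X c - (\<Union>d\<in>C'. cylinder X d)"
      by (auto simp: C'_def cylinder_def split_beta)
    ultimately show ?thesis
      using countable_subset[OF _ cnt] by blast
  next
    \<comment> \<open>With two values per coordinate, each coordinate now lies in only finitely many
      domains. An infinite subfamily has disjoint domains, and the root is empty.\<close>
    case False
    have "finite {c \<in> C. a \<in> fst ` c}" for a
    proof (rule finite_subset)
      show "{c \<in> C. a \<in> fst ` c} \<subseteq> {c \<in> C. (a, True) \<in> c} \<union> {c \<in> C. (a, False) \<in> c}"
        by auto (metis (full_types))
    qed (use False in blast)
    moreover have "finite (fst ` c)" if "c \<in> C" for c
      using C[OF that] by simp
    ultimately obtain D where D: "D \<subseteq> C" "infinite D"
        and disj: "\<And>c d. c \<in> D \<Longrightarrow> d \<in> D \<Longrightarrow> c \<noteq> d \<Longrightarrow> fst ` c \<inter> fst ` d = {}"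
      using infinite_disjoint_subfamily[OF inf, of "image fst"] by blast
    have "countable (X - (\<Union>c\<in>D. cylinder X c))"
      using HFC_disjoint_cylinders[OF wo X D(2) _ disj] C D(1) by blast
    then have "countable (cylinder X {} - (\<Union>c\<in>C. cylinder X c))"
      by (rule countable_subset[rotated]) (use D(1) in \<open>auto simp: cylinder_def\<close>)
    moreover have "C \<noteq> {}"
      using inf by auto
    then have "\<exists>d\<in>C. {} \<subseteq> d"
      by blast
    ultimately show ?thesis
      by (intro exI[of _ "{}"]) simp
  qed
qed

section \<open>Elementary cylinder facts and compactness by branching\<close>

lemma single_valued_cylinder: "cylinder X c \<noteq> {} \<Longrightarrow> single_valued c"
  unfolding cylinder_def single_valued_def by blast

lemma cylinder_empty [simp]: "cylinder X {} = X"
  by (simp add: cylinder_def)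

lemma cylinder_anti_mono: "c \<subseteq> d \<Longrightarrow> cylinder X d \<subseteq> cylinder X c"
  by (auto simp: cylinder_def)

text \<open>Compactness as in Koenig's lemma: a bad set split by one more coordinate has a bad half,
  and the nested choices converge to \<open>q\<close>.\<close>

lemma binary_branch:
  fixes e :: "nat \<Rightarrow> 'b \<Rightarrow> bool"
  assumes X: "\<not> good X" and Un: "\<And>A B. good A \<Longrightarrow> good B \<Longrightarrow> good (A \<union> B)"
  shows "\<exists>q. \<forall>n. \<not> good {x \<in> X. \<forall>i<n. e i x = q i}"
proof -
  define W where "W q n = {x \<in> X. \<forall>i<n. e i x = q i}" for q :: "nat \<Rightarrow> bool" and n
  have "\<exists>f. \<forall>n. \<not> good (W (f n) n) \<and> (\<forall>i<n. f (Suc n) i = f n i)"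
  proof (rule dependent_nat_choice)
    show "\<exists>q. \<not> good (W q 0)"
      using X by (simp add: W_def)
    fix q n
    assume bad: "\<not> good (W q n)"
    have "W q n = W (q(n := True)) (Suc n) \<union> W (q(n := False)) (Suc n)"
      by (auto simp: W_def less_Suc_eq)
    then obtain v where "\<not> good (W (q(n := v)) (Suc n))"
      using bad Un by metis
    then show "\<exists>p. \<not> good (W p (Suc n)) \<and> (\<forall>i<n. p i = q i)"
      by (intro exI[of _ "q(n := v)"]) simp
  qed
  then obtain f where f: "\<And>n. \<not> good (W (f n) n)" "\<And>n i. i < n \<Longrightarrow> f (Suc n) i = f n i"
    by metis
  \<comment> \<open>From stage \<open>Suc i\<close> on, the value at \<open>i\<close> is
    frozen.\<close>
  have diagonal: "f n i = f (Suc i) i" if "i < n" for n i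
    using that
  proof (induction n)
    case (Suc n)
    then show ?case
      using f(2)[of i n] by (cases "i = n") auto
  qed simp
  have "W (f n) n = W (\<lambda>i. f (Suc i) i) n" for n
    unfolding W_def by (rule Collect_cong) (metis diagonal)
  then have "\<not> good (W (\<lambda>i. f (Suc i) i) n)" for n
    using f(1)[of n] by simp
  then show ?thesis
    unfolding W_def by (intro exI allI)
qed

section \<open>Neighbourhood assignments by cylinders\<close>

locale HFC_space =
  fixes r :: "'a rel" and X :: "('a \<Rightarrow> bool) set"
  assumes wo: "Well_order r" and infinite_Field: "infinite (Field r)" and HFC: "HFC r X"
begin

abbreviation T :: "('a \<Rightarrow> bool) topology" where
  "T \<equiv> subtopology (cantor_cube r) X"

lemma X_subset: "X \<subseteq> topspace (cantor_cube r)"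
  using HFC by (simp add: HFC_def)

lemma topspace_T [simp]: "topspace T = X"
  using X_subset by auto

lemma closedin_X: "closedin T X"
  using closedin_topspace[of T] unfolding topspace_T .

lemma openin_X: "openin T X"
  using openin_topspace[of T] unfolding topspace_T .

lemma t1_space_T: "t1_space T"
  unfolding cantor_cube_def
  by (intro t1_space_subtopology Hausdorff_imp_t1_space) (simp add: Hausdorff_space_product_topology)

lemma continuous_coordinate:
  "a \<in> Field r \<Longrightarrow> continuous_map T (discrete_topology UNIV) (\<lambda>x. x a)"
  unfolding cantor_cube_def
  by (rule continuous_map_from_subtopology) (rule continuous_map_product_projection)

lemma closedin_cylinder:
  assumes "c \<subseteq> Field r \<times> UNIV"
  shows "closedin T (cylinder X c)"
proof -
  have "closedin T {x \<in> X. x a = i}" if "(a, i) \<in> c" for a i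
    using closedin_continuous_map_preimage[OF continuous_coordinate, of a "{i}"] assms that
    by (auto simp del: topspace_subtopology)
  then have "closedin T (\<Inter>p\<in>c. {x \<in> X. x (fst p) = snd p})" if "c \<noteq> {}"
    using that by (intro closedin_Inter) auto
  moreover have "cylinder X c = (\<Inter>p\<in>c. {x \<in> X. x (fst p) = snd p})" if "c \<noteq> {}"
    using that by (auto simp: cylinder_def split_beta)
  ultimately show ?thesis
    using closedin_X by (cases "c = {}") auto
qed

lemma openin_cylinder:
  assumes "finite c" and "c \<subseteq> Field r \<times> UNIV"
  shows "openin T (cylinder X c)"
proof -
  have "openin T {x \<in> X. x a = i}" if "(a, i) \<in> c" for a i
    using openin_continuous_map_preimage[OF continuous_coordinate, of a "{i}"] assms that
    by (auto simp del: topspace_subtopology)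
  then have "openin T (\<Inter>p\<in>c. {x \<in> X. x (fst p) = snd p})" if "c \<noteq> {}"
    using that assms(1) by (intro openin_Inter) auto
  moreover have "cylinder X c = (\<Inter>p\<in>c. {x \<in> X. x (fst p) = snd p})" if "c \<noteq> {}"
    using that by (auto simp: cylinder_def split_beta)
  ultimately show ?thesis
    using openin_X by (cases "c = {}") auto
qed

lemma cylinder_base:
  assumes "openin T V" and "x \<in> V"
  shows "\<exists>c. finite c \<and> c \<subseteq> Field r \<times> UNIV \<and> x \<in> cylinder X c \<and> cylinder X c \<subseteq> V"
proof -
  obtain V' where V': "openin (cantor_cube r) V'" "V = V' \<inter> X"
    using assms(1) by (auto simp: openin_subtopology)
  then obtain u where fin: "finite {i \<in> Field r. u i \<noteq> UNIV}" and xu: "x \<in> Pi\<^sub>E (Field r) u"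
      and uV: "Pi\<^sub>E (Field r) u \<subseteq> V'"
    using assms(2) by (auto simp: cantor_cube_def openin_product_topology_alt)
  \<comment> \<open>The values of \<open>x\<close> at the finitely many coordinates that the basic
    open set restricts.\<close>
  let ?c = "(\<lambda>a. (a, x a)) ` {i \<in> Field r. u i \<noteq> UNIV}"
  have "cylinder X ?c \<subseteq> V"
  proof
    fix y assume y: "y \<in> cylinder X ?c"
    then have "y \<in> Pi\<^sub>E (Field r) (\<lambda>_. UNIV)"
      using X_subset by (auto simp: cylinder_def cantor_cube_def)
    moreover have "y a \<in> u a" if "a \<in> Field r" for a
      using y xu that by (cases "u a = UNIV") (auto simp: cylinder_def)
    ultimately have "y \<in> Pi\<^sub>E (Field r) u"
      by auto
    then show "y \<in> V"
      using uV y V' by (auto simp: cylinder_def)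
  qed
  moreover have "x \<in> cylinder X ?c"
    using assms(2) V' by (auto simp: cylinder_def)
  ultimately show ?thesis
    using fin by (intro exI[of _ ?c]) auto
qed

text \<open>A point outside all the one-coordinate cylinders \<open>{(e i, \<not> q i)}\<close>
  agrees with \<open>q\<close> everywhere, and HFC applies to these.\<close>

lemma countable_fibre:
  fixes e :: "nat \<Rightarrow> 'a"
  assumes "inj e" and "range e \<subseteq> Field r"
  shows "countable (cylinder X (range (\<lambda>i. (e i, q i))))"
proof -
  let ?C = "range (\<lambda>i. {(e i, \<not> q i)})"
  have "infinite ?C"
    using assms(1) by (intro range_inj_infinite) (auto simp: inj_def)
  then have "countable (X - (\<Union>c\<in>?C. cylinder X c))"
  proof (rule HFC_disjoint_cylinders[OF wo HFC])
    show "finite c \<and> card c \<le> 1 \<and> c \<subseteq> Field r \<times> UNIV \<and> single_valued c" if "c \<in> ?C" for c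
      using that assms(2) by (auto simp: single_valued_def)
    show "fst ` c \<inter> fst ` d = {}" if "c \<in> ?C" "d \<in> ?C" "c \<noteq> d" for c d
      using that by (auto simp: inj_eq[OF assms(1)])
  qed
  then show ?thesis
    by (rule countable_subset[rotated]) (auto simp: cylinder_def)
qed

end

section \<open>Descent on the size of the root\<close>

locale cylinder_assignment = HFC_space +
  fixes s :: "('a \<Rightarrow> bool) \<Rightarrow> ('a \<times> bool) set"
  assumes s: "x \<in> X \<Longrightarrow> finite (s x) \<and> s x \<subseteq> Field r \<times> UNIV \<and> x \<in> cylinder X (s x)"
begin

definition U :: "('a \<Rightarrow> bool) set \<Rightarrow> ('a \<Rightarrow> bool) set" where
  "U D = (\<Union>x\<in>D. cylinder X (s x))"

text \<open>\<open>D\<close> is drawn from \<open>E\<close> itself, so that it stays off regions cut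
  out of \<open>E\<close> before; its points may lie outside \<open>S\<close>.\<close>

definition coverable :: "('a \<Rightarrow> bool) set \<Rightarrow> ('a \<Rightarrow> bool) set \<Rightarrow> bool" where
  "coverable S E \<longleftrightarrow> (\<exists>D\<subseteq>E. closed_discrete T D \<and> S \<inter> E \<subseteq> U D)"

text \<open>The invariant of the descent. The exceptional set is countable on the whole cylinder, as
  required for combining with HFC; meeting \<open>E\<close> is what makes successive cylinders
  distinct.\<close>

definition has_root :: "nat \<Rightarrow> ('a \<Rightarrow> bool) set \<Rightarrow> bool" where
  "has_root m E \<longleftrightarrow> (\<exists>A c. A \<subseteq> E \<and> closed_discrete T A \<and> finite c \<and> card c \<le> m \<and>
     c \<subseteq> Field r \<times> UNIV \<and> cylinder X c \<inter> E \<noteq> {} \<and> countable (cylinder X c - U A))"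

lemma neighbourhood_assignment_cylinder: "neighbourhood_assignment T (\<lambda>x. cylinder X (s x))"
  using s openin_cylinder by (simp add: neighbourhood_assignment_def)

lemma openin_U:
  assumes "D \<subseteq> X"
  shows "openin T (U D)"
proof -
  have "openin T (cylinder X (s x))" if "x \<in> D" for x
    using s[of x] assms that by (intro openin_cylinder) auto
  then show ?thesis
    unfolding U_def by (intro openin_Union) auto
qed

lemma U_mono: "A \<subseteq> B \<Longrightarrow> U A \<subseteq> U B"
  by (auto simp: U_def)

lemma U_Un: "U (A \<union> B) = U A \<union> U B"
  by (auto simp: U_def)

lemma countable_coverable:
  assumes "closedin T E" and "countable E"
  shows "\<exists>D\<subseteq>E. closed_discrete T D \<and> E \<subseteq> U D"
  using closed_discrete_cover_countable[OF neighbourhood_assignment_cylinder t1_space_T assms]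
  by (simp add: U_def)

lemma has_root_step:
  assumes IH: "\<And>E. closedin T E \<Longrightarrow> \<not> coverable S E \<Longrightarrow> has_root (Suc m) E"
    and E: "closedin T E" and unc: "\<not> coverable S E"
  shows "has_root m E"
proof -
  have EX: "E \<subseteq> X"
    using closedin_subset[OF E] by simp
  obtain e :: "nat \<Rightarrow> 'a" where e: "inj e" "range e \<subseteq> Field r"
    using infinite_countable_subset[OF infinite_Field] by blast
  \<comment> \<open>Coverability over \<open>W\<close> alone, with \<open>D\<close> still drawn from
    all of \<open>E\<close>; this is stable under unions, as branching requires.\<close>
  define good where "good W \<longleftrightarrow> (\<exists>D\<subseteq>E. closed_discrete T D \<and> S \<inter> E \<inter> W \<subseteq> U D)" for W
  have "\<not> good X"
    using unc EX by (auto simp: good_def coverable_def)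
  moreover have "good (A \<union> B)" if "good A" "good B" for A B
  proof -
    obtain D D' where "D \<subseteq> E" "closed_discrete T D" "S \<inter> E \<inter> A \<subseteq> U D"
        "D' \<subseteq> E" "closed_discrete T D'" "S \<inter> E \<inter> B \<subseteq> U D'"
      using \<open>good A\<close> \<open>good B\<close> unfolding good_def by blast
    then show ?thesis
      unfolding good_def by (intro exI[of _ "D \<union> D'"]) (auto simp: U_Un closed_discrete_Un)
  qed
  ultimately obtain q where q: "\<And>n. \<not> good {x \<in> X. \<forall>i<n. x (e i) = q i}"
    using binary_branch[of good X "\<lambda>i x. x (e i)"] by blast
  define w where "w n = (\<lambda>i. (e i, q i)) ` {..<n}" for n :: nat
  define W where "W n = cylinder X (w n)" for n
  define Z where "Z = cylinder X (range (\<lambda>i. (e i, q i)))"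
  have w: "finite (w n)" "w n \<subseteq> Field r \<times> UNIV" for n
    using e(2) by (auto simp: w_def)
  have W_eq: "W n = {x \<in> X. \<forall>i<n. x (e i) = q i}" for n
    by (auto simp: W_def w_def cylinder_def)
  have bad: "\<not> good (W n)" for n
    using q by (simp add: W_eq)
  have "closedin T Z"
    using e(2) unfolding Z_def by (intro closedin_cylinder) auto
  moreover have "countable Z"
    unfolding Z_def by (rule countable_fibre[OF e])
  \<comment> \<open>Every later block avoids the open set \<open>U D0\<close>, hence cannot
    accumulate at points of \<open>E\<close> in the fibre.\<close>
  ultimately obtain D0 where D0: "D0 \<subseteq> Z \<inter> E" "closed_discrete T D0" "Z \<inter> E \<subseteq> U D0"
    using countable_coverable[of "Z \<inter> E"] E by auto

  \<comment> \<open>The assertion \<open>has_root (Suc m)\<close> for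
    \<open>E \<inter> W n - U G\<close>, with its witnesses named.\<close>
  let ?R = "\<lambda>n G A c. A \<subseteq> E \<inter> W n - U G \<and> closed_discrete T A \<and> finite c \<and> card c \<le> Suc m \<and>
     c \<subseteq> Field r \<times> UNIV \<and> cylinder X c \<inter> (E \<inter> W n - U G) \<noteq> {} \<and> countable (cylinder X c - U A)"
  have "\<exists>G. \<forall>n. (closed_discrete T (G n) \<and> G n \<subseteq> E \<and> D0 \<subseteq> G n) \<and>
    (G n \<subseteq> G (Suc n) \<and> (\<exists>A c. ?R n (G n) A c \<and> cylinder X c \<inter> (E \<inter> W n) \<subseteq> U (G (Suc n))))"
    (is "\<exists>G. ?Q G")
  proof (rule dependent_nat_choice)
    show "\<exists>G. closed_discrete T G \<and> G \<subseteq> E \<and> D0 \<subseteq> G"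
      using D0 by blast
  next
    fix G n
    assume G: "closed_discrete T G \<and> G \<subseteq> E \<and> D0 \<subseteq> G"
    define E' where "E' = E \<inter> W n - U G"
    have E': "closedin T E'"
      using E closedin_cylinder[OF w(2)] openin_U[of G] G EX
      unfolding E'_def W_def by (intro closedin_diff closedin_Int) auto
    \<comment> \<open>Otherwise adding \<open>G\<close> would make \<open>W n\<close> good.\<close>
    have "\<not> coverable S E'"
    proof
      assume "coverable S E'"
      then obtain D where "D \<subseteq> E'" "closed_discrete T D" "S \<inter> E' \<subseteq> U D"
        unfolding coverable_def by blast
      then have "good (W n)"
        unfolding good_def using G closed_discrete_Un
        by (intro exI[of _ "D \<union> G"]) (auto simp: E'_def U_Un)
      then show False
        using bad by blast
    qed
    then obtain A c where A: "A \<subseteq> E'" "closed_discrete T A" "finite c" "card c \<le> Suc m"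
        "c \<subseteq> Field r \<times> UNIV" "cylinder X c \<inter> E' \<noteq> {}" "countable (cylinder X c - U A)"
      using IH[OF E'] unfolding has_root_def by blast
    \<comment> \<open>The countable remainder is covered by a set \<open>B\<close>, so that the new
      stage covers the part of \<open>cylinder X c\<close> in \<open>E \<inter> W n\<close>
      completely.\<close>
    have "closedin T (cylinder X c \<inter> E' - U A)"
      using E' closedin_cylinder[OF A(5)] openin_U[of A] A(1) EX
      by (intro closedin_diff closedin_Int) (auto simp: E'_def)
    moreover have "countable (cylinder X c \<inter> E' - U A)"
      by (rule countable_subset[OF _ A(7)]) blast
    ultimately have "\<exists>B\<subseteq>cylinder X c \<inter> E' - U A.
        closed_discrete T B \<and> cylinder X c \<inter> E' - U A \<subseteq> U B"
      by (rule countable_coverable)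
    then obtain B where B: "B \<subseteq> cylinder X c \<inter> E' - U A" "closed_discrete T B"
        "cylinder X c \<inter> E' - U A \<subseteq> U B"
      by metis
    let ?G = "G \<union> A \<union> B"
    have "cylinder X c \<inter> (E \<inter> W n) \<subseteq> U ?G"
      using B(3) by (auto simp: U_Un E'_def)
    moreover have "closed_discrete T ?G"
      using G A(2) B(2) by (simp add: closed_discrete_Un)
    moreover have "?G \<subseteq> E" "D0 \<subseteq> ?G" "G \<subseteq> ?G"
      using G A(1) B(1) by (auto simp: E'_def)
    moreover have "?R n G A c"
      using A by (simp add: E'_def)
    ultimately show "\<exists>H. (closed_discrete T H \<and> H \<subseteq> E \<and> D0 \<subseteq> H) \<and>
      (G \<subseteq> H \<and> (\<exists>A c. ?R n G A c \<and> cylinder X c \<inter> (E \<inter> W n) \<subseteq> U H))"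
      by metis
  qed
  then obtain G where "?Q G" ..
  then have G: "\<And>n. D0 \<subseteq> G n" "\<And>n. G n \<subseteq> G (Suc n)"
    and "\<forall>n. \<exists>A c. ?R n (G n) A c \<and> cylinder X c \<inter> (E \<inter> W n) \<subseteq> U (G (Suc n))"
    by metis+
  then obtain A c where R: "\<And>n. ?R n (G n) (A n) (c n)"
    and cG: "\<And>n. cylinder X (c n) \<inter> (E \<inter> W n) \<subseteq> U (G (Suc n))"
    by metis
  have G_mono: "G k \<subseteq> G n" if "k \<le> n" for k n
    using that by (rule lift_Suc_mono_le[of G, OF G(2)])
  have W_mono: "W n \<subseteq> W k" if "k \<le> n" for k n
    using that by (auto simp: W_eq)

  \<comment> \<open>The cylinder of \<open>c l\<close> has a point of \<open>E \<inter> W l\<close>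
    outside \<open>U (G l)\<close>, whereas stage \<open>Suc k\<close> has covered all such points
    of the cylinder of \<open>c k\<close>.\<close>
  have "c k \<noteq> c l" if "k < l" for k l
  proof
    assume "c k = c l"
    obtain x where "x \<in> cylinder X (c l) \<inter> (E \<inter> W l - U (G l))"
      using R by blast
    moreover have "U (G (Suc k)) \<subseteq> U (G l)"
      using that by (intro U_mono G_mono) simp
    ultimately show False
      using cG[of k] W_mono[of k l] that \<open>c k = c l\<close> by auto
  qed
  then have "inj c"
    by (intro linorder_injI) auto
  then have "infinite (range c)"
    by (rule range_inj_infinite)
  moreover have "finite d \<and> card d \<le> Suc m \<and> d \<subseteq> Field r \<times> UNIV \<and> single_valued d"
    if "d \<in> range c" for d
    using that R single_valued_cylinder by blast
  ultimately obtain d k where d: "card d \<le> m" "d \<subseteq> c k"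
      and cnt: "countable (cylinder X d - (\<Union>c\<in>range c. cylinder X c))"
    using HFC_cylinders_root[OF wo HFC, of "range c" m] by blast
  let ?A = "\<Union>n. A n"
  have A_sub: "A n \<subseteq> E \<inter> W n - U (G n)" for n
    using R by blast
  have "closed_discrete T ?A"
  proof (rule closed_discreteI)
    show "?A \<subseteq> topspace T"
      using A_sub EX unfolding topspace_T by blast
    fix x assume "x \<in> topspace T"
    then have x: "x \<in> X"
      by simp
    consider "x \<notin> E" | "x \<in> E" "x \<in> Z" | i where "x \<notin> W (Suc i)"
      using x by (auto simp: Z_def W_def w_def cylinder_def)
    then show "\<exists>V B. openin T V \<and> x \<in> V \<and> closed_discrete T B \<and> V \<inter> ?A \<subseteq> B"
    proof cases
      case 1
      then show ?thesis
        using openin_diff[OF openin_X E] A_sub x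
        by (intro exI[of _ "X - E"] exI[of _ "{}"]) (auto simp: closed_discrete_empty)
    next
      case 2
      have "U D0 \<inter> A n = {}" for n
        using A_sub[of n] U_mono[OF G(1)[of n]] by blast
      then show ?thesis
        using 2 D0 EX openin_U[of D0]
        by (intro exI[of _ "U D0"] exI[of _ "{}"]) (auto simp: closed_discrete_empty)
    next
      case (3 i)
      \<comment> \<open>Blocks with index above \<open>i\<close> lie inside
        \<open>W (Suc i)\<close>, so its complement meets only the finitely many blocks up to
        \<open>i\<close>.\<close>
      have "openin T (X - W (Suc i))"
        unfolding W_def by (intro openin_diff openin_X closedin_cylinder w)
      moreover have "A n \<subseteq> W (Suc i)" if "\<not> n \<le> i" for n
        using A_sub[of n] W_mono[of "Suc i" n] that by auto
      then have "(X - W (Suc i)) \<inter> ?A \<subseteq> (\<Union>n\<le>i. A n)"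
        by fastforce
      moreover have "closed_discrete T (\<Union>n\<le>i. A n)"
        using R by (intro closed_discrete_UN) auto
      ultimately show ?thesis
        using 3 x by (intro exI[of _ "X - W (Suc i)"] exI[of _ "\<Union>n\<le>i. A n"]) auto
    qed
  qed
  moreover have "?A \<subseteq> E"
    using A_sub by blast
  moreover have "countable (cylinder X d - U ?A)"
  proof (rule countable_subset)
    have "U (A n) \<subseteq> U ?A" for n
      by (intro U_mono) blast
    then show "cylinder X d - U ?A \<subseteq>
        (cylinder X d - (\<Union>c\<in>range c. cylinder X c)) \<union> (\<Union>n. cylinder X (c n) - U (A n))"
      by blast
    show "countable \<dots>"
      using cnt R by auto
  qed
  moreover have "cylinder X d \<inter> E \<noteq> {}"
    using R[of k] cylinder_anti_mono[OF d(2)] by blast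
  moreover have "finite d" "d \<subseteq> Field r \<times> UNIV"
    using d(2) R[of k] finite_subset by blast+
  ultimately show ?thesis
    using d(1) unfolding has_root_def by blast
qed

text \<open>Downward induction from \<open>m\<close> to \<open>0\<close>, for all closed sets at
  once. A root of size \<open>0\<close> is empty, its cylinder is \<open>X\<close>, and only a
  countable set is left.\<close>

lemma coverable_bounded:
  assumes S: "\<And>x. x \<in> S \<Longrightarrow> card (s x) \<le> m" and E: "closedin T E"
  shows "coverable S E"
proof (rule ccontr)
  assume unc: "\<not> coverable S E"
  have "\<forall>E. closedin T E \<longrightarrow> \<not> coverable S E \<longrightarrow> has_root 0 E"
    using le0[of m]
  proof (induction rule: inc_induct)
    case base
    show ?case
    proof (intro allI impI)
      fix E assume E: "closedin T E" "\<not> coverable S E"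
      \<comment> \<open>Since \<open>{}\<close> does not cover, there is a point \<open>x\<close> of
        \<open>S\<close> in \<open>E\<close>; its own cylinder \<open>s x\<close> with
        \<open>A = {x}\<close> is a root without exceptions.\<close>
      then have "\<not> S \<inter> E \<subseteq> {}"
        using closed_discrete_empty by (auto simp: coverable_def)
      then obtain x where x: "x \<in> S" "x \<in> E"
        by blast
      then have xX: "x \<in> X"
        using closedin_subset[OF E(1)] by auto
      then have "closed_discrete T {x}"
        by (intro closed_discrete_singleton t1_space_T) (simp only: topspace_T)
      then show "has_root m E"
        unfolding has_root_def using x s[OF xX] S
        by (intro exI[of _ "{x}"] exI[of _ "s x"]) (auto simp: U_def)
    qed
  next
    case (step k)
    then show ?case
      using has_root_step by metis
  qed
  then have "has_root 0 E"
    using E unc by metis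
  then obtain A c where A: "A \<subseteq> E" "closed_discrete T A"
      and c: "finite c" "card c \<le> 0" "countable (cylinder X c - U A)"
    unfolding has_root_def by metis
  then have "c = {}"
    by simp
  then have cnt: "countable (X - U A)"
    using c(3) by simp
  have EX: "E \<subseteq> X"
    using closedin_subset[OF E] by simp
  have "closedin T (E - U A)"
    using E openin_U[of A] A(1) EX by (intro closedin_diff) auto
  moreover have "countable (E - U A)"
    by (rule countable_subset[OF _ cnt]) (use EX in blast)
  ultimately have "\<exists>B\<subseteq>E - U A. closed_discrete T B \<and> E - U A \<subseteq> U B"
    by (rule countable_coverable)
  then obtain B where "B \<subseteq> E - U A" "closed_discrete T B" "E - U A \<subseteq> U B"
    by metis
  then have "coverable S E"
    unfolding coverable_def using A
    by (intro exI[of _ "A \<union> B"]) (auto simp: U_Un closed_discrete_Un)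
  then show False
    using unc by blast
qed

text \<open>The layers of constant size \<open>card (s x)\<close> are coverable one by one, and
  stacking joins them.\<close>

lemma closed_discrete_cover: "\<exists>D\<subseteq>X. closed_discrete T D \<and> X \<subseteq> U D"
  unfolding U_def
proof (rule closed_discrete_cover_stack[OF neighbourhood_assignment_cylinder closedin_X])
    show "X \<subseteq> (\<Union>n. {x. card (s x) = n})"
      by blast
    show "\<exists>D\<subseteq>E. closed_discrete T D \<and> {x. card (s x) = n} \<inter> E \<subseteq> (\<Union>x\<in>D. cylinder X (s x))"
      if "closedin T E" for n E
      using coverable_bounded[of "{x. card (s x) = n}" n E] that
      by (simp add: coverable_def U_def)
qed

end

section \<open>Arbitrary neighbourhood assignments\<close>

theorem theorem4:
  fixes r :: "'a rel" and X :: "('a \<Rightarrow> bool) set"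
  assumes "Card_order r" and "uncountable (Field r)" and "HFC r X"
  shows "dually_discrete (subtopology (cantor_cube r) X)"
proof -
  interpret HFC_space r X
  proof
    show "Well_order r"
      using assms(1) by (simp add: card_order_on_def)
    show "infinite (Field r)"
      using assms(2) countable_finite by blast
  qed (rule assms(3))
  show ?thesis
    unfolding dually_discrete_def
  proof (intro allI impI)
    fix V assume V: "neighbourhood_assignment T V"
    have VX: "openin T (V x)" "x \<in> V x" if "x \<in> X" for x
      using V that unfolding neighbourhood_assignment_def topspace_T by auto
    \<comment> \<open>Shrinking to cylinders is harmless: a cover by the smaller sets yields one by
      the sets \<open>V x\<close>.\<close>
    then have "\<exists>c. finite c \<and> c \<subseteq> Field r \<times> UNIV \<and> x \<in> cylinder X c \<and> cylinder X c \<subseteq> V x"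
      if "x \<in> X" for x
      using that by (intro cylinder_base)
    then obtain s where base: "\<And>x. x \<in> X \<Longrightarrow> finite (s x) \<and> s x \<subseteq> Field r \<times> UNIV \<and>
        x \<in> cylinder X (s x) \<and> cylinder X (s x) \<subseteq> V x"
      by metis
    interpret cylinder_assignment r X s
      by unfold_locales (use base in metis)
    obtain D where D: "D \<subseteq> X" "closed_discrete T D" "X \<subseteq> U D"
      using closed_discrete_cover by blast
    have "V x \<subseteq> X" if "x \<in> D" for x
      using openin_subset[OF VX(1)] that D(1) unfolding topspace_T by blast
    moreover have "U D \<subseteq> (\<Union>x\<in>D. V x)"
      unfolding U_def using base D(1) by (intro UN_mono) auto
    ultimately have "(\<Union>x\<in>D. V x) = X"
      using D(3) by blast
    then show "\<exists>D\<subseteq>topspace T. subtopology T D = discrete_topology D \<and> (\<Union>x\<in>D. V x) = topspace T"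
      using D(1) subtopology_closed_discrete[OF D(2)] unfolding topspace_T by blast
  qed
qed

end
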